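(* Let $\phi=(\phi_1,\dots,\phi_m)$ be any dyadic probability distribution on the ordered symbols $s_1\prec\dots\prec s_m$. Then one can construct in linear time (i.e. $O(m)$ time) an alphabetic code $C$ for $s_1\prec\dots\prec s_m$ whose average length satisfies $$\mathbb{E}[C]\le H(\phi)+2-\phi_1\bigl(2-\log_2\phi_1-\lceil-\log_2\phi_1\rceil\bigr)-\phi_m\bigl(2-\log_2\phi_m-\lceil-\log_2\phi_m\rceil\bigr)-\sum_{i=1}^{m-1}\min(\phi_i,\phi_{i+1})$$ $$=H(\phi)+2-2\phi_1-2\phi_m-\sum_{i=1}^{m-1}\min(\phi_i,\phi_{i+1}).$$
   Context: A (binary) alphabetic code for ordered symbols $s_1\prec\dots\prec s_m$ is a map $w:\{s_1,\dots,s_m\}\to\{0,1\}^+$ that is order preserving with respect to the alphabetical (lexicographic) order on binary strings and prefix-free; equivalently, it is a binary tree with edges labelled $0$ (left) and $1$ (right) whose leaves, read from left to right, are $s_1,\dots,s_m$, the codeword $w(s_i)$ being the sequence of labels on the path from the root to the leaf $s_i$. If $\ell_i$ is the length of $w(s_i)$, the average length of $C$ under $\phi$ is $\mathbb{E}[C]=\sum_{i=1}^m\phi_i\ell_i$. $H(\phi)=-\sum_{i=1}^m\phi_i\log_2\phi_i$ is the Shannon entropy. A distribution is dyadic if each $\phi_i$ equals $2^{-k_i}$ for a suitable integer $k_i>0$. Running time counts elementary operations on numbers (arithmetic, comparisons, floors/ceilings, base-2 logarithms, bitwise XOR) at unit cost.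
   Formalization: The construction and the bound on the average length are stated for m ≥ 3 only: for m = 2 the only dyadic distribution is (1/2, 1/2), where the bound equals 1/2 but every code has average length at least 1. The equality of the two bounds is stated for all m. *)

theory Defs
  imports Complex_Main "HOL-Library.Sublist"
begin

section \<open>Distributions and alphabetic codes\<close>

text \<open>The symbols are the numbers \<open>1, \<dots>, m\<close> in their natural order; only the values
  \<open>\<phi> 1, \<dots>, \<phi> m\<close> of a distribution and \<open>w 1, \<dots>, w m\<close> of a code are relevant.\<close>

definition dyadic_distribution :: "nat \<Rightarrow> (nat \<Rightarrow> real) \<Rightarrow> bool" where
  "dyadic_distribution m \<phi> \<longleftrightarrow>
     (\<forall>i\<in>{1..m}. \<exists>k::nat. k > 0 \<and> \<phi> i = 1 / 2 ^ k) \<and> (\<Sum>i=1..m. \<phi> i) = 1"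

definition entropy :: "nat \<Rightarrow> (nat \<Rightarrow> real) \<Rightarrow> real" where
  "entropy m \<phi> = - (\<Sum>i=1..m. \<phi> i * log 2 (\<phi> i))"

text \<open>In a codeword, \<^const>\<open>False\<close> is the bit 0 and \<^const>\<open>True\<close> is the bit 1.\<close>

definition alphabetic_code :: "nat \<Rightarrow> (nat \<Rightarrow> bool list) \<Rightarrow> bool" where
  "alphabetic_code m w \<longleftrightarrow>
     (\<forall>i\<in>{1..m}. w i \<noteq> []) \<and>
     (\<forall>i\<in>{1..m}. \<forall>j\<in>{1..m}. i < j \<longrightarrow> (w i, w j) \<in> lexord {(False, True)}) \<and>
     (\<forall>i\<in>{1..m}. \<forall>j\<in>{1..m}. i \<noteq> j \<longrightarrow> \<not> prefix (w i) (w j))"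

definition average_length :: "nat \<Rightarrow> (nat \<Rightarrow> real) \<Rightarrow> (nat \<Rightarrow> bool list) \<Rightarrow> real" where
  "average_length m \<phi> w = (\<Sum>i=1..m. \<phi> i * real (length (w i)))"


section \<open>Programs and their running time\<close>

text \<open>Algorithms are programs of a small imperative language with real-valued variables and
  arrays.  A program is a finite syntactic object with integer constants only, so that one
  program has to serve all inputs.\<close>

datatype unop = Floor | Ceiling | Log2

datatype binop = Add | Sub | Mul | Div | Xor

datatype exp =
    Const int
  | Var string
  | Get string exp
  | Unary unop exp
  | Binary binop exp exp

datatype bexp =
    Less exp exp
  | Equal exp exp
  | BNot bexp
  | BAnd bexp bexp

datatype com =
    Skip
  | Assign string exp
  | Put string exp exp
  | Seq com com
  | If bexp com com
  | While bexp com

record state =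
  reg :: "string \<Rightarrow> real"
  mem :: "string \<Rightarrow> nat \<Rightarrow> real"

fun unop_val :: "unop \<Rightarrow> real \<Rightarrow> real" where
  "unop_val Floor x = of_int \<lfloor>x\<rfloor>"
| "unop_val Ceiling x = of_int \<lceil>x\<rceil>"
| "unop_val Log2 x = log 2 x"

text \<open>Bitwise XOR is an operation on integers; its operands are rounded down first.\<close>

fun binop_val :: "binop \<Rightarrow> real \<Rightarrow> real \<Rightarrow> real" where
  "binop_val Add x y = x + y"
| "binop_val Sub x y = x - y"
| "binop_val Mul x y = x * y"
| "binop_val Div x y = x / y"
| "binop_val Xor x y = of_int (Bit_Operations.xor \<lfloor>x\<rfloor> \<lfloor>y\<rfloor>)"

definition index :: "real \<Rightarrow> nat" where
  "index x = nat \<lfloor>x\<rfloor>"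

fun exp_val :: "exp \<Rightarrow> state \<Rightarrow> real" where
  "exp_val (Const n) s = of_int n"
| "exp_val (Var x) s = reg s x"
| "exp_val (Get a e) s = mem s a (index (exp_val e s))"
| "exp_val (Unary f e) s = unop_val f (exp_val e s)"
| "exp_val (Binary f e1 e2) s = binop_val f (exp_val e1 s) (exp_val e2 s)"

fun bexp_val :: "bexp \<Rightarrow> state \<Rightarrow> bool" where
  "bexp_val (Less e1 e2) s \<longleftrightarrow> exp_val e1 s < exp_val e2 s"
| "bexp_val (Equal e1 e2) s \<longleftrightarrow> exp_val e1 s = exp_val e2 s"
| "bexp_val (BNot b) s \<longleftrightarrow> \<not> bexp_val b s"
| "bexp_val (BAnd b1 b2) s \<longleftrightarrow> bexp_val b1 s \<and> bexp_val b2 s"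

text \<open>Every constant, variable or array access, operation, comparison and connective costs one
  unit of time, and so does the execution of every basic command and every test.\<close>

fun exp_time :: "exp \<Rightarrow> nat" where
  "exp_time (Const n) = 1"
| "exp_time (Var x) = 1"
| "exp_time (Get a e) = exp_time e + 1"
| "exp_time (Unary f e) = exp_time e + 1"
| "exp_time (Binary f e1 e2) = exp_time e1 + exp_time e2 + 1"

fun bexp_time :: "bexp \<Rightarrow> nat" where
  "bexp_time (Less e1 e2) = exp_time e1 + exp_time e2 + 1"
| "bexp_time (Equal e1 e2) = exp_time e1 + exp_time e2 + 1"
| "bexp_time (BNot b) = bexp_time b + 1"
| "bexp_time (BAnd b1 b2) = bexp_time b1 + bexp_time b2 + 1"

definition assign :: "string \<Rightarrow> real \<Rightarrow> state \<Rightarrow> state" where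
  "assign x v s = s\<lparr>reg := (reg s)(x := v)\<rparr>"

definition put :: "string \<Rightarrow> nat \<Rightarrow> real \<Rightarrow> state \<Rightarrow> state" where
  "put a i v s = s\<lparr>mem := (mem s)(a := (mem s a)(i := v))\<rparr>"

text \<open>\<open>exec c s t s'\<close>: started in \<open>s\<close>, the program \<open>c\<close> halts in \<open>s'\<close> after time \<open>t\<close>.\<close>

inductive exec :: "com \<Rightarrow> state \<Rightarrow> nat \<Rightarrow> state \<Rightarrow> bool" where
  Skip: "exec Skip s 1 s"
| Assign: "exec (Assign x e) s (exp_time e + 1) (assign x (exp_val e s) s)"
| Put: "exec (Put a e1 e2) s (exp_time e1 + exp_time e2 + 1)
          (put a (index (exp_val e1 s)) (exp_val e2 s) s)"
| Seq: "exec c1 s t1 s' \<Longrightarrow> exec c2 s' t2 s'' \<Longrightarrow> exec (Seq c1 c2) s (t1 + t2) s''"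
| IfTrue: "bexp_val b s \<Longrightarrow> exec c1 s t s' \<Longrightarrow> exec (If b c1 c2) s (bexp_time b + t + 1) s'"
| IfFalse: "\<not> bexp_val b s \<Longrightarrow> exec c2 s t s' \<Longrightarrow> exec (If b c1 c2) s (bexp_time b + t + 1) s'"
| WhileFalse: "\<not> bexp_val b s \<Longrightarrow> exec (While b c) s (bexp_time b + 1) s"
| WhileTrue: "bexp_val b s \<Longrightarrow> exec c s t1 s' \<Longrightarrow> exec (While b c) s' t2 s'' \<Longrightarrow>
    exec (While b c) s (bexp_time b + t1 + t2 + 1) s''"


section \<open>Input and output\<close>

definition input_state :: "nat \<Rightarrow> (nat \<Rightarrow> real) \<Rightarrow> state" where
  "input_state m \<phi> =
     \<lparr>reg = (\<lambda>_. 0)(''m'' := real m),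
      mem = (\<lambda>_ _. 0)(''phi'' := (\<lambda>i. if i \<in> {1..m} then \<phi> i else 0))\<rparr>"

text \<open>The codewords can have quadratic total length, so a program outputs the code as a
  binary tree in linked representation.  \<^term>\<open>Empty\<close> stands for a missing child.\<close>

datatype code_tree = Empty | Leaf nat | Node code_tree code_tree

fun codewords :: "code_tree \<Rightarrow> (nat \<times> bool list) list" where
  "codewords Empty = []"
| "codewords (Leaf i) = [(i, [])]"
| "codewords (Node l r) =
     map (apsnd ((#) False)) (codewords l) @ map (apsnd ((#) True)) (codewords r)"

text \<open>A pointer 0 is null, a pointer \<open>i\<close> in \<open>{1..m}\<close> is the leaf for symbol \<open>i\<close>, and
  a pointer \<open>n > m\<close> is an inner node, whose children are found in two arrays.\<close>

fun stored_tree :: "nat \<Rightarrow> state \<Rightarrow> real \<Rightarrow> code_tree \<Rightarrow> bool" where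
  "stored_tree m s v Empty \<longleftrightarrow> v = 0"
| "stored_tree m s v (Leaf i) \<longleftrightarrow> i \<in> {1..m} \<and> v = real i"
| "stored_tree m s v (Node l r) \<longleftrightarrow>
     (\<exists>n::nat. n > m \<and> v = real n \<and>
        stored_tree m s (mem s ''left'' n) l \<and> stored_tree m s (mem s ''right'' n) r)"

definition outputs_code :: "nat \<Rightarrow> state \<Rightarrow> (nat \<Rightarrow> bool list) \<Rightarrow> bool" where
  "outputs_code m s w \<longleftrightarrow>
     (\<exists>T. stored_tree m s (reg s ''root'') T \<and> codewords T = map (\<lambda>i. (i, w i)) [1..<Suc m])"

text \<open>For two symbols the only dyadic distribution is (1/2, 1/2).  There the value
  \<open>H + 2 - 2 \<phi> 1 - 2 \<phi> 2 - min (\<phi> 1) (\<phi> 2)\<close> is 1/2, so that no code can attain it; the bound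
  on the average length can only be claimed for at least three symbols.\<close>

lemma no_code_two_symbols:
  assumes "dyadic_distribution 2 \<phi>" "alphabetic_code 2 w"
  shows "\<not> average_length 2 \<phi> w \<le>
           entropy 2 \<phi> + 2 - 2 * \<phi> 1 - 2 * \<phi> 2 - (\<Sum>i=1..2-1. min (\<phi> i) (\<phi> (i+1)))"
proof -
  have le: "x \<le> 1/2" if "\<exists>k::nat. k > 0 \<and> x = 1 / 2 ^ k" for x :: real
  proof -
    from that obtain k :: nat where k: "k > 0 \<and> x = 1 / 2 ^ k" ..
    then have "(2::real) ^ 1 \<le> 2 ^ k" by (intro power_increasing) auto
    then have "1 / 2 ^ k \<le> 1 / (2::real)" by (intro divide_left_mono) auto
    then show ?thesis using k by simp
  qed
  have s: "{1..2::nat} = {1, 2}" by auto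
  have d: "\<forall>i\<in>{1,2}. \<exists>k::nat. k > 0 \<and> \<phi> i = 1 / 2 ^ k" "(\<Sum>i\<in>{1,2}. \<phi> i) = 1"
    using assms(1) unfolding dyadic_distribution_def s by simp_all
  have "\<phi> 1 \<le> 1/2" "\<phi> 2 \<le> 1/2" using d(1) by (intro le; simp)+
  moreover have "\<phi> 1 + \<phi> 2 = 1" using d(2) by simp
  ultimately have phi: "\<phi> 1 = 1/2" "\<phi> 2 = 1/2" by linarith+
  have "w 1 \<noteq> []" "w 2 \<noteq> []"
    using assms(2) unfolding alphabetic_code_def s by simp_all
  then have "real (length (w 1)) \<ge> 1" "real (length (w 2)) \<ge> 1"
    by (simp_all add: Suc_le_eq)
  moreover have "average_length 2 \<phi> w = \<phi> 1 * length (w 1) + \<phi> 2 * length (w 2)"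
    unfolding average_length_def s by simp
  ultimately have "average_length 2 \<phi> w \<ge> 1" unfolding phi by linarith
  moreover have "log 2 (1/2) = - (1::real)"
    using log_inverse[of 2 "2::real"] by (simp add: inverse_eq_divide)
  moreover have "entropy 2 \<phi> = - (\<phi> 1 * log 2 (\<phi> 1) + \<phi> 2 * log 2 (\<phi> 2))"
    unfolding entropy_def s by simp
  ultimately have "average_length 2 \<phi> w \<ge> 1" "entropy 2 \<phi> = 1" unfolding phi by simp_all
  moreover have "(\<Sum>i=1..2-1. min (\<phi> i) (\<phi> (i+1))) = min (\<phi> 1) (\<phi> 2)"
  proof -
    have "{1..2-1::nat} = {1}" "(1::nat) + 1 = 2" by auto
    then show ?thesis by (simp only: sum.insert sum.empty finite.emptyI empty_iff
          not_False_eq_True add_0_right)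
  qed
  ultimately show ?thesis unfolding phi by linarith
qed

end

theory Submission
  imports Defs
begin

text \<open>Give symbol \<open>i\<close> the codeword length \<open>- log\<^sub>2 \<phi>\<^sub>i + 1\<close>, except for the last symbol, which gets
  \<open>- log\<^sub>2 \<phi>\<^sub>m\<close>, and the first two: if \<open>\<phi>\<^sub>2 \<le> \<phi>\<^sub>1\<close>, both get \<open>- log\<^sub>2 \<phi>\<^sub>i\<close>, and otherwise the first gets
  \<open>- log\<^sub>2 \<phi>\<^sub>1 - 1\<close>.  The average length is then \<open>H + 1 - \<phi>\<^sub>1 - \<phi>\<^sub>m - min(\<phi>\<^sub>1, \<phi>\<^sub>2)\<close>, and this is at most
  the bound, because \<open>min(\<phi>\<^sub>i, \<phi>\<^sub>i\<^sub>+\<^sub>1) \<le> \<phi>\<^sub>i\<close> for \<open>1 < i < m\<close>.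

  An alphabetic code with at most these lengths exists if dyadic intervals of the corresponding
  sizes can be packed into the unit interval from left to right, each starting at a multiple
  of its size.  An interval of size \<open>\<phi>\<^sub>i/2\<close> can always be placed in
  \<open>[\<phi>\<^sub>1 + \<dots> + \<phi>\<^sub>i\<^sub>-\<^sub>1, \<phi>\<^sub>1 + \<dots> + \<phi>\<^sub>i]\<close>, and the exceptional intervals fit because dyadic numbers divide
  each other.  Greedy packing with a stack of trees, whose sizes are the binary digits of the space
  used so far, takes amortised constant time per symbol.\<close>

section \<open>Execution with postconditions on time and state\<close>

definition runs :: "com \<Rightarrow> state \<Rightarrow> (nat \<Rightarrow> state \<Rightarrow> bool) \<Rightarrow> bool" where
  "runs c s Q \<longleftrightarrow> (\<exists>t s'. exec c s t s' \<and> Q t s')"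

lemma runs_Skip: "Q 1 s \<Longrightarrow> runs Skip s Q"
  unfolding runs_def using exec.Skip by blast

lemma runs_Assign: "Q (exp_time e + 1) (assign x (exp_val e s) s) \<Longrightarrow> runs (Assign x e) s Q"
  unfolding runs_def using exec.Assign by blast

lemma runs_Put:
  "Q (exp_time e1 + exp_time e2 + 1) (put a (index (exp_val e1 s)) (exp_val e2 s) s) \<Longrightarrow>
   runs (Put a e1 e2) s Q"
  unfolding runs_def using exec.Put by blast

lemma runs_Seq:
  "runs c1 s (\<lambda>t1 s1. runs c2 s1 (\<lambda>t2 s2. Q (t1 + t2) s2)) \<Longrightarrow> runs (Seq c1 c2) s Q"
  unfolding runs_def using exec.Seq by blast

lemma runs_If:
  assumes "bexp_val b s \<Longrightarrow> runs c1 s (\<lambda>t. Q (bexp_time b + t + 1))"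
    and "\<not> bexp_val b s \<Longrightarrow> runs c2 s (\<lambda>t. Q (bexp_time b + t + 1))"
  shows "runs (If b c1 c2) s Q"
  using assms exec.IfTrue exec.IfFalse unfolding runs_def by (cases "bexp_val b s") blast+

lemma runs_mono: "runs c s Q \<Longrightarrow> (\<And>t s'. Q t s' \<Longrightarrow> R t s') \<Longrightarrow> runs c s R"
  unfolding runs_def by blast

text \<open>\<open>g\<close> is a potential that pays for every round together with its test, so it
  also forces termination; the last, failing test is the extra \<open>bexp_time b + 1\<close>.
  Keeping \<open>g s'\<close> on the left lets an enclosing loop go on spending what is
  left.\<close>

lemma runs_While:
  fixes g :: "state \<Rightarrow> nat"
  assumes step: "\<And>s. I s \<Longrightarrow> bexp_val b s \<Longrightarrow>
      runs c s (\<lambda>t s'. I s' \<and> g s' + t + bexp_time b + 1 \<le> g s)"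
    and "I s"
  shows "runs (While b c) s (\<lambda>t s'. I s' \<and> \<not> bexp_val b s' \<and> t + g s' \<le> g s + bexp_time b + 1)"
  using \<open>I s\<close>
proof (induction "g s" arbitrary: s rule: less_induct)
  case less
  show ?case
  proof (cases "bexp_val b s")
    case False
    then show ?thesis using less.prems exec.WhileFalse[OF False, of c] unfolding runs_def by force
  next
    case True
    obtain t1 s1 where 1: "exec c s t1 s1" "I s1" "g s1 + t1 + bexp_time b + 1 \<le> g s"
      using step[OF less.prems True] unfolding runs_def by blast
    then obtain t2 s2 where 2: "exec (While b c) s1 t2 s2" "I s2" "\<not> bexp_val b s2"
      "t2 + g s2 \<le> g s1 + bexp_time b + 1"
      using less.hyps[of s1] unfolding runs_def by auto
    have "bexp_time b + t1 + t2 + 1 + g s2 \<le> g s + bexp_time b + 1"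
      using 1(3) 2(4) by linarith
    then show ?thesis
      using exec.WhileTrue[OF True 1(1) 2(1)] 2(2,3) unfolding runs_def by blast
  qed
qed


section \<open>Codes from trees\<close>

text \<open>A single relation that yields both the lexicographic order and incomparability under
  \<open>prefix\<close>, and that survives prepending a common bit.\<close>

definition branches :: "bool list \<Rightarrow> bool list \<Rightarrow> bool" where
  "branches x y \<longleftrightarrow> (\<exists>p a b. x = p @ False # a \<and> y = p @ True # b)"

lemma branches_Cons: "branches x y \<Longrightarrow> branches (c # x) (c # y)"
  unfolding branches_def by (metis append_Cons)

lemma branches_False_True: "branches (False # x) (True # y)"
  unfolding branches_def by (metis append_Nil)

lemma codewords_branch: "sorted_wrt (\<lambda>x y. branches (snd x) (snd y)) (codewords T)"
proof (induction T)
  case (Node l r)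
  have "sorted_wrt (\<lambda>x y. branches (snd x) (snd y)) (map (apsnd ((#) c)) xs)"
    if "sorted_wrt (\<lambda>x y. branches (snd x) (snd y)) xs"
    for c and xs :: "(nat \<times> bool list) list"
    unfolding sorted_wrt_map
    by (rule sorted_wrt_mono_rel[OF _ that]) (simp add: branches_Cons)
  then show ?case
    using Node by (auto simp: sorted_wrt_append branches_False_True)
qed simp_all

lemma alphabetic_code_codewords:
  assumes T: "codewords T = map (\<lambda>i. (i, w i)) [1..<Suc m]" and "m \<ge> 2"
  shows "alphabetic_code m w"
proof -
  have branch: "branches (w i) (w j)" if "i \<in> {1..m}" "j \<in> {1..m}" "i < j" for i j
  proof -
    have "sorted_wrt (\<lambda>i j. branches (w i) (w j)) [1..<Suc m]"
      using codewords_branch[of T] unfolding T sorted_wrt_map by simp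
    from sorted_wrt_nth_less[OF this, of "i - 1" "j - 1"] show ?thesis
      using that by (auto simp del: upt_Suc)
  qed
  have "w i \<noteq> []" if "i \<in> {1..m}" for i
  \<comment> \<open>A word that branches off another one is not empty; word 1 needs word 2 as its
    partner, hence \<open>m \<ge> 2\<close>.\<close>
  proof (cases "i = 1")
    case True then show ?thesis using branch[of 1 2] \<open>m \<ge> 2\<close> by (auto simp: branches_def)
  next
    case False then show ?thesis using branch[of 1 i] that by (auto simp: branches_def)
  qed
  moreover have "(w i, w j) \<in> lexord {(False, True)} \<and> \<not> prefix (w i) (w j) \<and> \<not> prefix (w j) (w i)"
    if "i \<in> {1..m}" "j \<in> {1..m}" "i < j" for i j
    using branch[OF that] by (auto simp: branches_def intro: lexord_append_left_rightI)
  ultimately show ?thesis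
    unfolding alphabetic_code_def by (metis nat_neq_iff)
qed


section \<open>Powers of two\<close>

text \<open>The exponent is an integer because sizes both below and above 1 occur.\<close>

definition pow2 :: "real \<Rightarrow> bool" where
  "pow2 x \<longleftrightarrow> (\<exists>z::int. x = 2 powi z)"

definition multiple :: "real \<Rightarrow> real \<Rightarrow> bool" where
  "multiple a x \<longleftrightarrow> (\<exists>z::int. x = of_int z * a)"

lemma pow2_pos: "pow2 x \<Longrightarrow> x > 0"
  by (auto simp: pow2_def)

lemma pow2_mult2: "pow2 x \<Longrightarrow> pow2 (2 * x)"
  unfolding pow2_def by (metis power_int_add_1' zero_neq_numeral)

lemma pow2_inverse_power: "pow2 (1 / 2 ^ k)"
  unfolding pow2_def by (intro exI[of _ "- int k"]) (simp add: power_int_minus divide_inverse)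

lemma pow2_le_obtain:
  assumes "pow2 a" "pow2 b" "a \<le> b"
  obtains n :: nat where "b = 2 ^ n * a"
proof -
  obtain y z where yz: "a = 2 powi y" "b = 2 powi z"
    using assms by (auto simp: pow2_def)
  have "y \<le> z"
    using assms(3) power_int_strict_increasing[of z y "2::real"] unfolding yz by force
  then have "b = 2 ^ nat (z - y) * a"
    unfolding yz by (simp add: power_int_diff flip: power_int_of_nat)
  then show thesis by (rule that)
qed

lemma pow2_less: "pow2 a \<Longrightarrow> pow2 b \<Longrightarrow> a < b \<Longrightarrow> 2 * a \<le> b"
proof -
  assume *: "pow2 a" "pow2 b" "a < b"
  then obtain n where n: "b = 2 ^ n * a" using pow2_le_obtain[of a b] by auto
  then have "n \<noteq> 0" using *(3) by (intro notI) simp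
  then obtain k where "n = Suc k" by (cases n) auto
  then show "2 * a \<le> b" using n pow2_pos[OF *(1)] by simp
qed

lemma multiple_pow2: "pow2 a \<Longrightarrow> pow2 b \<Longrightarrow> a \<le> b \<Longrightarrow> multiple a b"
  by (metis pow2_le_obtain multiple_def of_int_numeral of_int_power)

lemma multiple_0: "multiple a 0"
  unfolding multiple_def by (intro exI[of _ 0]) simp

lemma multiple_add: "multiple a x \<Longrightarrow> multiple a y \<Longrightarrow> multiple a (x + y)"
  unfolding multiple_def by (metis distrib_right of_int_add)

lemma multiple_diff: "multiple a x \<Longrightarrow> multiple a y \<Longrightarrow> multiple a (x - y)"
  unfolding multiple_def by (metis left_diff_distrib of_int_diff)

lemma multiple_trans: "multiple a b \<Longrightarrow> multiple b x \<Longrightarrow> multiple a x"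
  unfolding multiple_def by (metis mult.assoc of_int_mult)

lemma multiple_sum_list: "(\<And>x. x \<in> set xs \<Longrightarrow> multiple a x) \<Longrightarrow> multiple a (sum_list xs)"
  by (induction xs) (auto intro: multiple_0 multiple_add)

text \<open>The integer factors differ by at least 1. This is how leftover space is rounded up to a
  whole block of size \<open>a\<close>.\<close>

lemma multiple_less:
  assumes "multiple a x" "multiple a y" "x < y" "a > 0"
  shows "x + a \<le> y"
proof -
  obtain p q where pq: "x = of_int p * a" "y = of_int q * a"
    using assms by (auto simp: multiple_def)
  have "p + 1 \<le> q" using assms(3,4) unfolding pq by simp
  then have "of_int (p + 1) * a \<le> of_int q * a"
    using assms(4) by (intro mult_right_mono) (simp_all only: of_int_le_iff)
  then show ?thesis by (simp add: pq distrib_right)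
qed


section \<open>The program\<close>

fun tree_below :: "nat \<Rightarrow> nat \<Rightarrow> (nat \<Rightarrow> real) \<Rightarrow> (nat \<Rightarrow> real) \<Rightarrow> real \<Rightarrow> code_tree \<Rightarrow> bool" where
  "tree_below m n L R v Empty \<longleftrightarrow> v = 0"
| "tree_below m n L R v (Leaf i) \<longleftrightarrow> i \<in> {1..m} \<and> v = real i"
| "tree_below m n L R v (Node l r) \<longleftrightarrow>
     (\<exists>k. m < k \<and> k < n \<and> v = real k \<and> tree_below m n L R (L k) l \<and> tree_below m n L R (R k) r)"

text \<open>\<open>n\<close> is the next free address and all inner nodes lie strictly below it, so
  allocating cell \<open>n\<close> touches no existing tree.\<close>

lemma tree_below_update:
  "tree_below m n L R v T \<Longrightarrow> tree_below m (Suc n) (L(n := x)) (R(n := y)) v T"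
proof (induction T arbitrary: v)
  case (Node l r)
  then obtain k where k: "m < k" "k < n" "v = real k"
    "tree_below m n L R (L k) l" "tree_below m n L R (R k) r" by auto
  then show ?case using Node.IH by (auto intro!: exI[of _ k])
qed auto

lemma stored_tree_if_tree_below:
  "tree_below m n (mem s ''left'') (mem s ''right'') v T \<Longrightarrow> stored_tree m s v T"
  by (induction T arbitrary: v) auto

text \<open>Stacks are given top first, but are stored from index 0 upwards.\<close>

fun stack_at :: "nat \<Rightarrow> nat \<Rightarrow> (nat \<Rightarrow> real) \<Rightarrow> (nat \<Rightarrow> real) \<Rightarrow> (nat \<Rightarrow> real) \<Rightarrow> (nat \<Rightarrow> real) \<Rightarrow>
    (real \<times> code_tree) list \<Rightarrow> bool" where
  "stack_at m n W P L R [] \<longleftrightarrow> True"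
| "stack_at m n W P L R ((w, T) # st) \<longleftrightarrow>
     W (length st) = w \<and> tree_below m n L R (P (length st)) T \<and> stack_at m n W P L R st"

lemma stack_at_update [simp]:
  "length st \<le> k \<Longrightarrow> stack_at m n (W(k := x)) P L R st = stack_at m n W P L R st"
  "length st \<le> k \<Longrightarrow> stack_at m n W (P(k := x)) L R st = stack_at m n W P L R st"
  by (induction st) auto

lemma stack_at_new_node:
  "stack_at m n W P L R st \<Longrightarrow> stack_at m (Suc n) W P (L(n := x)) (R(n := y)) st"
  by (induction st) (auto intro: tree_below_update)

definition represents :: "nat \<Rightarrow> (nat \<Rightarrow> real) \<Rightarrow> nat \<Rightarrow> (real \<times> code_tree) list \<Rightarrow> state \<Rightarrow> bool" where
  "represents m u i st s \<longleftrightarrow>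
     reg s ''m'' = real m \<and> reg s ''i'' = real i \<and> reg s ''j'' = real (length st) \<and>
     (\<forall>k\<in>{1..Suc m}. mem s ''phi'' k = u k) \<and>
     (\<exists>n>m. reg s ''n'' = real n \<and>
        stack_at m n (mem s ''w'') (mem s ''t'') (mem s ''left'') (mem s ''right'') st)"

section \<open>The commands of the greedy packing\<close>

definition "second_ix = Binary Sub (Var ''j'') (Const 2)"
definition "top_ix = Binary Sub (Var ''j'') (Const 1)"
definition "weight = Get ''phi'' (Var ''i'')"

text \<open>The older tree becomes the left child, which keeps the symbols in order. The new weight
  is twice that of the second tree, which amounts to padding a lighter top tree to equal
  size.\<close>

definition merge :: com where
  "merge =
     Seq (Put ''left'' (Var ''n'') (Get ''t'' second_ix))
    (Seq (Put ''right'' (Var ''n'') (Get ''t'' top_ix))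
    (Seq (Put ''t'' second_ix (Var ''n''))
    (Seq (Put ''w'' second_ix (Binary Mul (Const 2) (Get ''w'' second_ix)))
    (Seq (Assign ''n'' (Binary Add (Var ''n'') (Const 1)))
         (Assign ''j'' (Binary Sub (Var ''j'') (Const 1)))))))"

text \<open>A carry of a binary counter: merging stops once the second tree is strictly heavier than
  both the top tree and the next symbol.\<close>

definition must_merge :: bexp where
  "must_merge = BNot (BAnd (Less weight (Get ''w'' second_ix))
                           (Less (Get ''w'' top_ix) (Get ''w'' second_ix)))"

text \<open>Pads the used space to a multiple of the next size, so that the next interval starts
  aligned.\<close>

definition raise_top :: com where
  "raise_top = If (Less (Get ''w'' top_ix) weight) (Put ''w'' top_ix weight) Skip"

definition push :: com where
  "push =
     Seq (Put ''w'' (Var ''j'') weight)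
    (Seq (Put ''t'' (Var ''j'') (Var ''i''))
    (Seq (Assign ''j'' (Binary Add (Var ''j'') (Const 1)))
         (Assign ''i'' (Binary Add (Var ''i'') (Const 1)))))"

definition build :: com where
  "build = While (Less (Var ''i'') (Binary Add (Var ''m'') (Const 1)))
     (Seq push (Seq (While must_merge merge) raise_top))"

definition rescale :: com where
  "rescale =
     Seq (Put ''phi'' (Binary Add (Var ''m'') (Const 1)) (Const 2))
    (Seq (Put ''phi'' (Var ''m'') (Binary Mul (Const 2) (Get ''phi'' (Var ''m''))))
         (If (Less (Get ''phi'' (Const 1)) (Get ''phi'' (Const 2)))
            (Put ''phi'' (Const 1) (Binary Mul (Const 4) (Get ''phi'' (Const 1))))
            (Seq (Put ''phi'' (Const 1) (Binary Mul (Const 2) (Get ''phi'' (Const 1))))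
                 (Put ''phi'' (Const 2) (Binary Mul (Const 2) (Get ''phi'' (Const 2)))))))"

definition init :: com where
  "init =
     Seq (Put ''w'' (Const 0) (Const 4))
    (Seq (Assign ''n'' (Binary Add (Var ''m'') (Const 1)))
    (Seq (Assign ''i'' (Const 1))
         (Assign ''j'' (Const 1))))"

definition program :: com where
  "program = Seq (Seq rescale init) (Seq build (Assign ''root'' (Get ''t'' (Const 1))))"

section \<open>Effect of the commands on a represented stack\<close>

lemma index_of_nat [simp]: "index (real n) = n" "index 0 = 0" "index 1 = 1" "index 2 = 2"
  "index (1 + real n) = Suc n" "index (real n + 1) = Suc n"
  by (simp_all add: index_def nat_add_distrib)

lemma runs_merge:
  assumes "represents m u i ((w1, T1) # (w2, T2) # st) s"
  shows "runs merge s (\<lambda>t s'. t \<le> 60 \<and> represents m u i ((2 * w2, Node T2 T1) # st) s'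
           \<and> index (reg s ''j'') = Suc (index (reg s' ''j'')))"
proof -
  obtain n where n: "n > m" "reg s ''n'' = real n"
    "stack_at m n (mem s ''w'') (mem s ''t'') (mem s ''left'') (mem s ''right'')
       ((w1, T1) # (w2, T2) # st)"
    and r: "reg s ''m'' = real m" "reg s ''i'' = real i" "reg s ''j'' = 2 + real (length st)"
     "\<forall>k\<in>{1..Suc m}. mem s ''phi'' k = u k"
    using assms by (auto simp: represents_def)
  have ix: "index (1 + real (length st)) = Suc (length st)" "index (2 + real (length st)) = Suc (Suc (length st))"
     by (simp_all add: index_def nat_add_distrib)
  show ?thesis
    unfolding merge_def
    apply (intro runs_Seq runs_Put runs_Assign)
    using n r
    apply (simp add: represents_def assign_def put_def second_ix_def top_ix_def ix)
    \<comment> \<open>Address \<open>n\<close> now holds the merged node, so the next free one is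
      \<open>Suc n\<close>.\<close>
    apply (rule exI[of _ "Suc n"])
    apply (auto simp: stack_at_new_node intro!: tree_below_update)
    done
qed

lemma runs_push:
  assumes "represents m u i st s" "i \<in> {1..m}"
  shows "runs push s (\<lambda>t s'. t \<le> 30 \<and> represents m u (Suc i) ((u i, Leaf i) # st) s'
           \<and> index (reg s' ''j'') = Suc (index (reg s ''j'')))"
  unfolding push_def
  apply (intro runs_Seq runs_Put runs_Assign)
  using assms
  apply (auto simp: represents_def assign_def put_def weight_def)
  done

lemma runs_raise_top:
  assumes "represents m u i ((w, T) # st) s" "i \<in> {1..Suc m}"
  shows "runs raise_top s (\<lambda>t s'. t \<le> 30 \<and> represents m u i ((max w (u i), T) # st) s'
           \<and> index (reg s' ''j'') = index (reg s ''j''))"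
  unfolding raise_top_def
  apply (intro runs_If runs_Skip runs_Put)
  using assms
  apply (auto simp: represents_def put_def weight_def top_ix_def max_def)
  done

lemma must_merge_iff:
  assumes "represents m u i ((w1, T1) # (w2, T2) # st) s" "i \<in> {1..Suc m}"
  shows "bexp_val must_merge s \<longleftrightarrow> w2 \<le> u i \<or> w2 \<le> w1"
  using assms by (auto simp: represents_def must_merge_def weight_def top_ix_def second_ix_def)

section \<open>Greedy packing\<close>

text \<open>All lengths are doubled, so the unit interval has length 2. \<open>u k\<close> is the
  size of the interval of symbol \<open>k\<close>, and \<open>Q k\<close> is an aligned upper bound
  on its start; \<open>Suc m\<close> is a fictitious symbol that begins where the whole interval
  ends.\<close>

locale packing =
  fixes m :: nat and u Q :: "nat \<Rightarrow> real"
  assumes m: "m \<ge> 1"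
    and pow2_u: "k \<in> {1..Suc m} \<Longrightarrow> pow2 (u k)"
    and u_last: "u (Suc m) = 2"
    and Q_first: "Q 1 = 0"
    and Q_last: "Q (Suc m) = 2"
    and Q_step: "k \<in> {1..m} \<Longrightarrow> Q k + u k \<le> Q (Suc k)"
    and Q_multiple: "k \<in> {1..Suc m} \<Longrightarrow> multiple (u k) (Q k)"
begin

section \<open>Bounds and invariants of the packing\<close>

lemma u_pos: "k \<in> {1..Suc m} \<Longrightarrow> u k > 0"
  using pow2_u pow2_pos by blast

lemma Q_le_2:
  assumes "k \<in> {1..Suc m}"
  shows "Q k \<le> 2"
proof -
  have "k \<le> Suc m" "1 \<le> k" using assms by auto
  then show ?thesis
  proof (induction rule: inc_induct)
    case base then show ?case by (simp add: Q_last)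
  next
    case (step n)
    then show ?case using Q_step[of n] u_pos[of n] by auto
  qed
qed

lemma u_le_2:
  assumes "k \<in> {1..Suc m}"
  shows "u k \<le> 2"
proof (cases "k = Suc m")
  case True then show ?thesis by (simp add: u_last)
next
  case False
  have "Q n \<ge> 0" if "n \<in> {1..m}" for n
  proof -
    have "1 \<le> n" "n \<le> m" using that by auto
    then show ?thesis
    proof (induction rule: dec_induct)
      case base then show ?case using Q_first by simp
    next
      case (step n)
      then show ?case using Q_step[of n] u_pos[of n] by auto
    qed
  qed
  then show ?thesis using False assms Q_step[of k] Q_le_2[of "Suc k"] by fastforce
qed

text \<open>The invariant while merging. A tree of weight \<open>w\<close> occupies an interval of
  size \<open>w\<close>, of which a leaf at depth \<open>d\<close> receives
  \<open>w / 2 ^ d\<close>. Below the top the weights are distinct powers of two, the binary digits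
  of the space; only the top may tie with its neighbour, as after a carry.\<close>

definition forest :: "nat \<Rightarrow> (real \<times> code_tree) list \<Rightarrow> bool" where
  "forest i xs \<longleftrightarrow>
     concat (map (\<lambda>(w, T). map fst (codewords T)) (rev xs)) = [1..<i] \<and>
     (\<forall>(w, T)\<in>set xs. pow2 w \<and> (\<forall>(k, c)\<in>set (codewords T). 2 ^ length c * u k \<le> w)) \<and>
     (\<Sum>x\<leftarrow>xs. fst x) \<le> Q i \<and>
     sorted_wrt (\<lambda>x y. fst x < fst y) (tl xs) \<and> (\<forall>x\<in>set (tl xs). fst (hd xs) \<le> fst x)"

text \<open>The invariant before a push: no tie is left, and the used space is a multiple of
  \<open>u i\<close>, so symbol \<open>i\<close> can go on top.\<close>

definition reduced :: "nat \<Rightarrow> (real \<times> code_tree) list \<Rightarrow> bool" where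
  "reduced i xs \<longleftrightarrow>
     forest i xs \<and> sorted_wrt (\<lambda>x y. fst x < fst y) xs \<and> (\<forall>x\<in>set xs. u i \<le> fst x)"

text \<open>Together with \<open>u_le_2\<close> this protects the sentinel of weight 4 from being
  merged.\<close>

lemma forest_top_le_2:
  assumes "forest i ((w, T) # xs)" "i \<in> {1..Suc m}"
  shows "w \<le> 2"
proof -
  have "(\<Sum>x\<leftarrow>xs. fst x) \<ge> 0"
    using assms(1) by (intro sum_list_nonneg) (auto simp: forest_def dest!: pow2_pos)
  then show ?thesis using assms Q_le_2[of i] by (simp add: forest_def)
qed

lemma reduced_Nil: "reduced 1 []"
  using Q_first by (simp add: reduced_def forest_def)

lemma forest_push:
  assumes "reduced i xs" "i \<in> {1..m}"
  shows "forest (Suc i) ((u i, Leaf i) # xs)"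
  using assms pow2_u[of i] Q_step[of i] by (auto simp: forest_def reduced_def)

text \<open>Merging trees of different sizes wastes space, but the next symbol cannot use that space:
  \<open>Q i\<close> is a multiple of \<open>u i\<close>, hence of \<open>w2\<close>, and it exceeds the space below the top tree.\<close>

lemma forest_merge:
  assumes F: "forest i ((w1, T1) # (w2, T2) # xs)" and i: "i \<in> {1..Suc m}"
    and w2: "w2 \<le> u i \<or> w2 \<le> w1"
  shows "forest i ((2 * w2, Node T2 T1) # xs)"
proof -
  let ?R = "\<Sum>x\<leftarrow>xs. fst x"
  have pow: "pow2 w1" "pow2 w2" "\<And>x. x \<in> set xs \<Longrightarrow> pow2 (fst x)"
    and less: "\<And>x. x \<in> set xs \<Longrightarrow> w2 < fst x" and "w1 \<le> w2"
    and Q: "w1 + w2 + ?R \<le> Q i"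
    using F by (auto simp: forest_def)
  have "2 * w2 + ?R \<le> Q i"
  proof (cases "w2 \<le> w1")
    case True then show ?thesis using Q \<open>w1 \<le> w2\<close> by linarith
  next
    case False
    have "multiple w2 ?R"
      using pow less by (intro multiple_sum_list) (force intro: multiple_pow2)
    then have "multiple w2 (w2 + ?R)"
      by (rule multiple_add[rotated]) (simp add: multiple_pow2 pow)
    moreover have "multiple w2 (Q i)"
      using multiple_trans[OF multiple_pow2 Q_multiple[OF i]] pow2_u[OF i] w2 False pow by blast
    ultimately have "w2 + ?R + w2 \<le> Q i"
      using Q pow pow2_pos by (intro multiple_less) force+
    then show ?thesis by simp
  qed
  \<comment> \<open>A larger power of two is at least the double; equality is possible, which is why
    \<open>forest\<close> allows a tie at the top.\<close>
  moreover have "2 * w2 \<le> fst x" if "x \<in> set xs" for x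
    using less[OF that] pow that by (intro pow2_less) auto
  moreover have "2 ^ length c * u k \<le> w2" if "(k, c) \<in> set (codewords T1) \<union> set (codewords T2)" for k c
    using F that \<open>w1 \<le> w2\<close> by (fastforce simp: forest_def)
  ultimately show ?thesis
    using F pow by (auto simp: forest_def pow2_mult2 o_def)
qed

text \<open>The weights below the top are multiples of \<open>u i\<close>, and so is
  \<open>Q i\<close>, which exceeds their sum. Hence a block of size \<open>u i\<close> fits above
  them, and enlarging the top tree to that block stays within \<open>Q i\<close>.\<close>

lemma reduced_raise:
  assumes F: "forest i ((w, T) # xs)" and i: "i \<in> {1..Suc m}"
    and less: "xs \<noteq> [] \<Longrightarrow> w < fst (hd xs) \<and> u i < fst (hd xs)"
  shows "reduced i ((max w (u i), T) # xs)"
proof -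
  let ?R = "\<Sum>x\<leftarrow>xs. fst x"
  have pow: "pow2 w" "\<And>x. x \<in> set xs \<Longrightarrow> pow2 (fst x)" and Q: "w + ?R \<le> Q i"
    and sorted: "sorted_wrt (\<lambda>x y. fst x < fst y) xs"
    using F by (auto simp: forest_def)
  have *: "max w (u i) < fst x" if "x \<in> set xs" for x
    using less sorted that by (cases xs) force+
  have "u i + ?R \<le> Q i"
  proof -
    have "multiple (u i) ?R"
      using pow * pow2_u[OF i] by (intro multiple_sum_list) (force intro: multiple_pow2)
    then have "?R + u i \<le> Q i"
      using Q pow2_pos[OF pow(1)] Q_multiple[OF i] u_pos[OF i] by (intro multiple_less) auto
    then show ?thesis by simp
  qed
  then have "max w (u i) + ?R \<le> Q i" using Q by linarith
  moreover have "pow2 (max w (u i))" using pow pow2_u[OF i] by (simp add: max_def)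
  ultimately show ?thesis
    using F * sorted by (fastforce simp: reduced_def forest_def le_max_iff_disj)
qed

text \<open>The bottom element is a sentinel: it is heavier than any tree, so it is never merged.\<close>

definition with_bottom :: "(real \<times> code_tree) list \<Rightarrow> (real \<times> code_tree) list" where
  "with_bottom xs = xs @ [(4, Empty)]"

section \<open>Amortised analysis of the loops\<close>

lemma runs_merge_loop:
  assumes i: "i \<in> {1..Suc m}"
    and F: "forest i xs" "xs \<noteq> []" "represents m u i (with_bottom xs) s"
  shows "runs (While must_merge merge) s (\<lambda>t s'.
           (\<exists>w T ys. forest i ((w, T) # ys) \<and> represents m u i (with_bottom ((w, T) # ys)) s' \<and>
              (ys \<noteq> [] \<longrightarrow> w < fst (hd ys) \<and> u i < fst (hd ys))) \<and>
           t + 100 * index (reg s' ''j'') \<le> 100 * index (reg s ''j'') + 20)"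
proof -
  define I where "I = (\<lambda>s. \<exists>xs. forest i xs \<and> xs \<noteq> [] \<and> represents m u i (with_bottom xs) s)"
  \<comment> \<open>A merge removes one stack entry, which releases 100 units; these cover at most
    60 for the merge and 19 for the test.\<close>
  have time: "bexp_time must_merge = 18"
    by (simp add: must_merge_def weight_def top_ix_def second_ix_def)
  have "runs (While must_merge merge) s (\<lambda>t s'. I s' \<and> \<not> bexp_val must_merge s' \<and>
      t + 100 * index (reg s' ''j'') \<le> 100 * index (reg s ''j'') + bexp_time must_merge + 1)"
  proof (rule runs_While)
    show "I s" using F by (auto simp: I_def)
  next
    fix s assume "I s" and b: "bexp_val must_merge s"
    then obtain w1 T1 xs where xs: "forest i ((w1, T1) # xs)"
      "represents m u i (with_bottom ((w1, T1) # xs)) s"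
      unfolding I_def by (metis list.exhaust surj_pair)
    have "xs \<noteq> []"
    proof
      assume "xs = []"
      then have "4 \<le> u i \<or> 4 \<le> w1"
        using xs(2) must_merge_iff[of m u i w1 T1 4 Empty "[]" s] i b by (simp add: with_bottom_def)
      then show False using forest_top_le_2[OF xs(1) i] u_le_2[OF i] by linarith
    qed
    then obtain w2 T2 ys where ys: "xs = (w2, T2) # ys" by (metis list.exhaust surj_pair)
    have "w2 \<le> u i \<or> w2 \<le> w1"
      using must_merge_iff[of m u i w1 T1 w2 T2 "with_bottom ys" s] xs(2) i b
      by (simp add: ys with_bottom_def)
    then have F': "forest i ((2 * w2, Node T2 T1) # ys)"
      using forest_merge xs(1) i unfolding ys by blast
    have "runs merge s (\<lambda>t s'. t \<le> 60 \<and>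
        represents m u i ((2 * w2, Node T2 T1) # with_bottom ys) s' \<and>
        index (reg s ''j'') = Suc (index (reg s' ''j'')))"
      using xs(2) by (intro runs_merge) (simp add: ys with_bottom_def)
    then show "runs merge s (\<lambda>t s'. I s' \<and>
        100 * index (reg s' ''j'') + t + bexp_time must_merge + 1 \<le> 100 * index (reg s ''j''))"
    proof (rule runs_mono)
      fix t :: nat and s'
      assume *: "t \<le> 60 \<and>
        represents m u i ((2 * w2, Node T2 T1) # with_bottom ys) s' \<and>
        index (reg s ''j'') = Suc (index (reg s' ''j''))"
      then have "I s'" unfolding I_def using F'
        by (intro exI[of _ "(2 * w2, Node T2 T1) # ys"]) (simp add: with_bottom_def)
      then show "I s' \<and>
        100 * index (reg s' ''j'') + t + bexp_time must_merge + 1 \<le> 100 * index (reg s ''j'')"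
        using * by (simp add: time)
    qed
  qed
  then show ?thesis
  proof (rule runs_mono)
    fix t :: nat and s'
    assume *: "I s' \<and> \<not> bexp_val must_merge s' \<and>
      t + 100 * index (reg s' ''j'') \<le> 100 * index (reg s ''j'') + bexp_time must_merge + 1"
    then obtain w T ys where ys: "forest i ((w, T) # ys)"
      "represents m u i (with_bottom ((w, T) # ys)) s'"
      unfolding I_def by (metis list.exhaust surj_pair)
    have "w < fst (hd ys) \<and> u i < fst (hd ys)" if ne: "ys \<noteq> []"
    proof -
      obtain w2 T2 zs where "ys = (w2, T2) # zs" using ne by (metis list.exhaust surj_pair)
      then show ?thesis
        using must_merge_iff[of m u i w T w2 T2 "with_bottom zs" s'] ys(2) i *
        by (simp add: with_bottom_def not_le)
    qed
    then show "(\<exists>w T ys. forest i ((w, T) # ys) \<and>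
          represents m u i (with_bottom ((w, T) # ys)) s' \<and>
          (ys \<noteq> [] \<longrightarrow> w < fst (hd ys) \<and> u i < fst (hd ys))) \<and>
        t + 100 * index (reg s' ''j'') \<le> 100 * index (reg s ''j'') + 20"
      using ys * by (auto simp: time)
  qed
qed

lemma runs_build:
  assumes s: "represents m u 1 (with_bottom []) s"
  shows "runs build s (\<lambda>t s'.
           (\<exists>xs. reduced (Suc m) xs \<and> represents m u (Suc m) (with_bottom xs) s') \<and>
           t \<le> 300 * m + 110)"
proof -
  define I where
    "I = (\<lambda>s. \<exists>i xs. i \<in> {1..Suc m} \<and> reduced i xs \<and> represents m u i (with_bottom xs) s)"
  \<comment> \<open>A symbol releases 300 units. Its stack entry keeps 100 for a later merge; the
    other 200 cover the push, the failing merge test, \<open>raise_top\<close> and the loop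
    test.\<close>
  define g where "g = (\<lambda>s::state. 100 * index (reg s ''j'') + 300 * (Suc m - index (reg s ''i'')))"
  have reg_i: "reg s ''i'' = real i" "reg s ''m'' = real m" if "represents m u i st s" for i st s
    using that by (auto simp: represents_def)
  have "runs build s (\<lambda>t s'. I s' \<and>
      \<not> bexp_val (Less (Var ''i'') (Binary Add (Var ''m'') (Const 1))) s' \<and>
      t + g s' \<le> g s + bexp_time (Less (Var ''i'') (Binary Add (Var ''m'') (Const 1))) + 1)"
    unfolding build_def
  proof (rule runs_While)
    show "I s" using s reduced_Nil m by (auto simp: I_def)
  next
    fix s assume "I s" and b: "bexp_val (Less (Var ''i'') (Binary Add (Var ''m'') (Const 1))) s"
    then obtain i xs where i: "i \<in> {1..Suc m}" and xs: "reduced i xs"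
      and rep: "represents m u i (with_bottom xs) s"
      unfolding I_def by blast
    have im: "i \<in> {1..m}" using b i reg_i[OF rep] by simp
    have i1: "Suc i \<in> {1..Suc m}" using im by simp
    show "runs (Seq push (Seq (While must_merge merge) raise_top)) s (\<lambda>t s'. I s' \<and>
        g s' + t + bexp_time (Less (Var ''i'') (Binary Add (Var ''m'') (Const 1))) + 1 \<le> g s)"
    proof (rule runs_Seq, rule runs_mono, rule runs_push[OF rep im], rule runs_Seq)
      fix t1 :: nat and s1
      assume 1: "t1 \<le> 30 \<and> represents m u (Suc i) ((u i, Leaf i) # with_bottom xs) s1 \<and>
        index (reg s1 ''j'') = Suc (index (reg s ''j''))"
      then have rep1: "represents m u (Suc i) (with_bottom ((u i, Leaf i) # xs)) s1"
        by (simp add: with_bottom_def)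
      show "runs (While must_merge merge) s1 (\<lambda>t2 s2. runs raise_top s2 (\<lambda>t3 s3. I s3 \<and>
          g s3 + (t1 + (t2 + t3)) +
            bexp_time (Less (Var ''i'') (Binary Add (Var ''m'') (Const 1))) + 1 \<le> g s))"
      proof (rule runs_mono, rule runs_merge_loop[OF i1 forest_push[OF xs im] _ rep1])
        fix t2 :: nat and s2
        assume 2: "(\<exists>w T ys. forest (Suc i) ((w, T) # ys) \<and>
            represents m u (Suc i) (with_bottom ((w, T) # ys)) s2 \<and>
            (ys \<noteq> [] \<longrightarrow> w < fst (hd ys) \<and> u (Suc i) < fst (hd ys))) \<and>
          t2 + 100 * index (reg s2 ''j'') \<le> 100 * index (reg s1 ''j'') + 20"
        then obtain w T ys where ys: "forest (Suc i) ((w, T) # ys)"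
            "represents m u (Suc i) ((w, T) # with_bottom ys) s2"
            "ys \<noteq> [] \<Longrightarrow> w < fst (hd ys) \<and> u (Suc i) < fst (hd ys)"
          by (auto simp: with_bottom_def)
        show "runs raise_top s2 (\<lambda>t3 s3. I s3 \<and> g s3 + (t1 + (t2 + t3)) +
            bexp_time (Less (Var ''i'') (Binary Add (Var ''m'') (Const 1))) + 1 \<le> g s)"
        proof (rule runs_mono, rule runs_raise_top[OF ys(2) i1])
          fix t3 :: nat and s3
          assume 3: "t3 \<le> 30 \<and>
            represents m u (Suc i) ((max w (u (Suc i)), T) # with_bottom ys) s3 \<and>
            index (reg s3 ''j'') = index (reg s2 ''j'')"
          have "I s3"
            unfolding I_def using 3 reduced_raise[OF ys(1) i1 ys(3)] i1
            by (intro exI[of _ "Suc i"] exI[of _ "(max w (u (Suc i)), T) # ys"])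
              (simp add: with_bottom_def)
          moreover have "reg s3 ''i'' = real (Suc i)" using reg_i 3 by blast
          then have "index (reg s3 ''i'') = Suc i" by (metis index_of_nat(1))
          \<comment> \<open>Because \<open>i \<le> m\<close>, the truncated subtraction really drops
            by one.\<close>
          moreover have "Suc m - i = Suc (Suc m - Suc i)" using im by auto
          ultimately show "I s3 \<and> g s3 + (t1 + (t2 + t3)) +
              bexp_time (Less (Var ''i'') (Binary Add (Var ''m'') (Const 1))) + 1 \<le> g s"
            using 1 2 3 reg_i[OF rep] by (simp add: g_def)
        qed
      qed simp_all
    qed
  qed
  then show ?thesis
  proof (rule runs_mono)
    fix t :: nat and s'
    assume *: "I s' \<and> \<not> bexp_val (Less (Var ''i'') (Binary Add (Var ''m'') (Const 1))) s' \<and>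
      t + g s' \<le> g s + bexp_time (Less (Var ''i'') (Binary Add (Var ''m'') (Const 1))) + 1"
    then obtain i xs where i: "i \<in> {1..Suc m}" and xs: "reduced i xs"
      and rep: "represents m u i (with_bottom xs) s'"
      unfolding I_def by blast
    have "i = Suc m" using * i reg_i[OF rep] by auto
    \<comment> \<open>The 100 stems from the sentinel, which counts as a stack entry.\<close>
    moreover have "g s = 100 + 300 * m"
      using s by (simp add: g_def represents_def with_bottom_def)
    ultimately show "(\<exists>xs. reduced (Suc m) xs \<and> represents m u (Suc m) (with_bottom xs) s') \<and>
        t \<le> 300 * m + 110"
      using xs rep * by auto
  qed
qed

text \<open>Every weight is at least \<open>u (Suc m) = 2\<close>, while the total is at most
  \<open>Q (Suc m) = 2\<close>; there is room for only one tree.\<close>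

lemma reduced_final:
  assumes "reduced (Suc m) xs"
  obtains w T where "xs = [(w, T)]" "map fst (codewords T) = [1..<Suc m]"
    "\<forall>(k, c)\<in>set (codewords T). 2 ^ length c * u k \<le> 2"
proof -
  have F: "forest (Suc m) xs" and ge: "\<And>x. x \<in> set xs \<Longrightarrow> 2 \<le> fst x"
    using assms u_last by (auto simp: reduced_def)
  have "xs \<noteq> []" using F m by (auto simp: forest_def)
  then obtain w T ys where xs: "xs = (w, T) # ys" by (metis list.exhaust surj_pair)
  have "ys = []"
  proof (rule ccontr)
    assume "ys \<noteq> []"
    then obtain y zs where ys: "ys = y # zs" by (metis list.exhaust)
    have "(\<Sum>x\<leftarrow>zs. fst x) \<ge> 0"
      using ge by (intro sum_list_nonneg) (force simp: xs ys)
    then show False using F ge[of "(w, T)"] ge[of y] by (simp add: forest_def xs ys Q_last)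
  qed
  with F xs Q_last show thesis by (intro that[of w T]) (fastforce simp: forest_def)+
qed

lemma runs_build_root:
  assumes "represents m u 1 [(4, Empty)] s"
  shows "runs (Seq build (Assign ''root'' (Get ''t'' (Const 1)))) s (\<lambda>t s'. t \<le> 300 * m + 120 \<and>
           (\<exists>T. stored_tree m s' (reg s' ''root'') T \<and> map fst (codewords T) = [1..<Suc m] \<and>
              (\<forall>(k, c)\<in>set (codewords T). 2 ^ length c * u k \<le> 2)))"
proof (rule runs_Seq, rule runs_mono, rule runs_build)
  show "represents m u 1 (with_bottom []) s" using assms by (simp add: with_bottom_def)
next
  fix t :: nat and s'
  assume *: "(\<exists>xs. reduced (Suc m) xs \<and> represents m u (Suc m) (with_bottom xs) s') \<and> t \<le> 300 * m + 110"
  then obtain w T where rep: "represents m u (Suc m) (with_bottom [(w, T)]) s'"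
    and T: "map fst (codewords T) = [1..<Suc m]"
      "\<forall>(k, c)\<in>set (codewords T). 2 ^ length c * u k \<le> 2"
    by (metis reduced_final)
  \<comment> \<open>Entry 0 of the stack is the sentinel, so the tree is found in entry 1.\<close>
  have "\<exists>n. tree_below m n (mem s' ''left'') (mem s' ''right'') (mem s' ''t'' 1) T"
    using rep by (auto simp: represents_def with_bottom_def)
  then obtain n where "tree_below m n (mem s' ''left'') (mem s' ''right'') (mem s' ''t'' 1) T" ..
  then have "stored_tree m (assign ''root'' (mem s' ''t'' 1) s') (mem s' ''t'' 1) T"
    by (intro stored_tree_if_tree_below[of _ n]) (simp add: assign_def)
  then show "runs (Assign ''root'' (Get ''t'' (Const 1))) s' (\<lambda>t2 s2. t + t2 \<le> 300 * m + 120 \<and>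
      (\<exists>T. stored_tree m s2 (reg s2 ''root'') T \<and> map fst (codewords T) = [1..<Suc m] \<and>
         (\<forall>(k, c)\<in>set (codewords T). 2 ^ length c * u k \<le> 2)))"
    using * T by (intro runs_Assign) (auto simp: assign_def simp del: upt_Suc)
qed

end

section \<open>Dyadic distributions\<close>

lemma round_up:
  assumes "a > 0"
  shows "x \<le> a * of_int \<lceil>x / a\<rceil>" "a * of_int \<lceil>x / a\<rceil> < x + a"
    "multiple a (a * of_int \<lceil>x / a\<rceil>)" "multiple a x \<Longrightarrow> a * of_int \<lceil>x / a\<rceil> = x"
proof -
  show "x \<le> a * of_int \<lceil>x / a\<rceil>"
    using mult_right_mono[OF le_of_int_ceiling[of "x / a"], of a] assms by (simp add: mult.commute)
  have "of_int \<lceil>x / a\<rceil> < x / a + 1" by linarith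
  from mult_strict_right_mono[OF this assms] show "a * of_int \<lceil>x / a\<rceil> < x + a"
    using assms unfolding distrib_right mult.commute[of a] by simp
  show "multiple a (a * of_int \<lceil>x / a\<rceil>)" by (auto simp: multiple_def)
  show "multiple a x \<Longrightarrow> a * of_int \<lceil>x / a\<rceil> = x"
    using assms by (auto simp: multiple_def)
qed

text \<open>The sizes of the intervals, doubled.  The fictitious symbol \<open>m + 1\<close> of the maximal size 2 forces
  all remaining trees to be merged into one.\<close>

definition scaled :: "nat \<Rightarrow> (nat \<Rightarrow> real) \<Rightarrow> nat \<Rightarrow> real" where
  "scaled m \<phi> k =
     (if k = Suc m then 2
      else if k = m then 2 * \<phi> m
      else if k = 1 then (if \<phi> 1 < \<phi> 2 then 4 * \<phi> 1 else 2 * \<phi> 1)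
      else if k = 2 \<and> \<not> \<phi> 1 < \<phi> 2 then 2 * \<phi> 2
      else \<phi> k)"

text \<open>An upper bound on the (doubled) start of the interval of symbol \<open>k\<close>.\<close>

definition position :: "nat \<Rightarrow> (nat \<Rightarrow> real) \<Rightarrow> nat \<Rightarrow> real" where
  "position m \<phi> k =
     (let a = scaled m \<phi> k;
          x = (if k \<le> 1 then 0 else if k = 2 then scaled m \<phi> 1 else 2 * (\<Sum>i=1..<k. \<phi> i))
      in a * of_int \<lceil>x / a\<rceil>)"

context
  fixes m :: nat and \<phi> :: "nat \<Rightarrow> real"
  assumes dyadic: "dyadic_distribution m \<phi>"
begin

lemma \<phi>_pow2: "k \<in> {1..m} \<Longrightarrow> pow2 (\<phi> k)"
  using dyadic pow2_inverse_power unfolding dyadic_distribution_def by metis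

lemma \<phi>_pos: "k \<in> {1..m} \<Longrightarrow> \<phi> k > 0"
  using \<phi>_pow2 pow2_pos by blast

lemma sum_\<phi>: "(\<Sum>k=1..m. \<phi> k) = 1"
  using dyadic by (simp add: dyadic_distribution_def)

text \<open>The logarithm of a dyadic probability is an integer, so the ceiling rounds nothing and
  the two logarithms cancel.\<close>

lemma correction_eq_2:
  assumes "k \<in> {1..m}"
  shows "2 - log 2 (\<phi> k) - of_int \<lceil>- log 2 (\<phi> k)\<rceil> = 2"
proof -
  obtain n :: nat where "\<phi> k = 1 / 2 ^ n"
    using dyadic assms unfolding dyadic_distribution_def by blast
  then have "log 2 (\<phi> k) = - real n" by (simp add: log_divide log_nat_power)
  then show ?thesis by simp
qed

context
  assumes m3: "m \<ge> 3"
begin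

lemma scaled_pow2:
  assumes "k \<in> {1..Suc m}"
  shows "pow2 (scaled m \<phi> k)"
proof -
  have "pow2 1" using pow2_inverse_power[of 0] by simp
  then have "pow2 2" using pow2_mult2 by fastforce
  moreover have "pow2 (2 * \<phi> i) \<and> pow2 (4 * \<phi> i)" if "i \<in> {1..m}" for i
    using pow2_mult2[OF \<phi>_pow2[OF that]] pow2_mult2[of "2 * \<phi> i"] by simp
  ultimately show ?thesis
    using assms \<phi>_pow2[of k] m3 by (auto simp: scaled_def)
qed

lemma position_step:
  assumes "k \<in> {2..m}"
  shows "position m \<phi> k + scaled m \<phi> k \<le> 2 * (\<Sum>i=1..k. \<phi> i)"
proof -
  have pos: "scaled m \<phi> k > 0" using scaled_pow2 pow2_pos assms by simp
  have sum_k: "(\<Sum>i=1..k. \<phi> i) = (\<Sum>i=1..<k. \<phi> i) + \<phi> k"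
    using assms by (simp add: sum.last_plus atLeastLessThanSuc_atLeastAtMost[symmetric])
  consider "k = 2" | "3 \<le> k" "k < m" | "3 \<le> k" "k = m" using assms by fastforce
  then show ?thesis
  proof cases
    case 1
    have sum2: "(\<Sum>i=1..k. \<phi> i) = \<phi> 1 + \<phi> 2" using 1 by (simp add: numeral_2_eq_2)
    have pow: "pow2 (\<phi> 1)" "pow2 (\<phi> 2)" using \<phi>_pow2 m3 by auto
    show ?thesis
    proof (cases "\<phi> 1 < \<phi> 2")
      case True
      then have u: "scaled m \<phi> 1 = 4 * \<phi> 1" "scaled m \<phi> 2 = \<phi> 2"
        using m3 by (auto simp: scaled_def)
      then have p: "position m \<phi> k = \<phi> 2 * of_int \<lceil>4 * \<phi> 1 / \<phi> 2\<rceil>"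
        using 1 by (simp add: position_def Let_def)
      \<comment> \<open>\<open>\<phi> 2 / \<phi> 1\<close> is a power of two above 1. If it is 2,
        then \<open>4 * \<phi> 1\<close> is already aligned; if it is at least 4, then the first
        interval fits into one block of size \<open>\<phi> 2\<close>.\<close>
      consider "2 * \<phi> 1 = \<phi> 2" | "2 * (2 * \<phi> 1) \<le> \<phi> 2"
        using pow2_less[OF pow True] pow2_less[OF pow2_mult2[OF pow(1)] pow(2)] by linarith
      then show ?thesis
      proof cases
        case a: 1
        then have "4 * \<phi> 1 / \<phi> 2 = 2" using pow2_pos[OF pow(2)] by (simp add: field_simps)
        then show ?thesis using p u 1 sum2 a by simp
      next
        case b: 2
        then have "4 * \<phi> 1 / \<phi> 2 \<le> 1" using pow2_pos[OF pow(2)] by simp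
        then have "\<lceil>4 * \<phi> 1 / \<phi> 2\<rceil> \<le> 1" by simp
        then have "of_int \<lceil>4 * \<phi> 1 / \<phi> 2\<rceil> \<le> (1 :: real)" by linarith
        then have "position m \<phi> k \<le> \<phi> 2 * 1"
          unfolding p using pow2_pos[OF pow(2)] by (intro mult_left_mono) auto
        then show ?thesis using u 1 sum2 pow2_pos[OF pow(1)] by simp
      qed
    next
      case False
      then have u: "scaled m \<phi> 1 = 2 * \<phi> 1" "scaled m \<phi> 2 = 2 * \<phi> 2"
        using m3 by (auto simp: scaled_def)
      have "multiple (2 * \<phi> 2) (2 * \<phi> 1)"
        using False pow by (intro multiple_pow2 pow2_mult2) auto
      then have "position m \<phi> k = 2 * \<phi> 1"
        using round_up(4)[of "2 * \<phi> 2" "2 * \<phi> 1"] pow2_pos[OF pow(2)] u 1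
        by (simp add: position_def Let_def)
      then show ?thesis using u 1 sum2 by simp
    qed
  next
    case 2
    \<comment> \<open>Rounding up costs less than \<open>\<phi> k\<close> and the interval takes
      another \<open>\<phi> k\<close>, which together stays within the doubled share
      \<open>2 * \<phi> k\<close>.\<close>
    then have "scaled m \<phi> k = \<phi> k" by (simp add: scaled_def)
    then show ?thesis
      using round_up(2)[of "\<phi> k" "2 * (\<Sum>i=1..<k. \<phi> i)"] pos sum_k 2 by (simp add: position_def Let_def)
  next
    case 3
    then have u: "scaled m \<phi> k = 2 * \<phi> k" by (simp add: scaled_def)
    \<comment> \<open>The doubled space before the last symbol is \<open>2 - 2 * \<phi> m\<close>, a
      multiple of \<open>2 * \<phi> m\<close>; no rounding occurs, so the last symbol can use its
      full share.\<close>
    have S: "(\<Sum>i=1..<k. \<phi> i) = 1 - \<phi> k" using sum_k sum_\<phi> 3 by simp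
    have "pow2 (\<phi> k)" using \<phi>_pow2 3 by simp
    moreover have "\<phi> k \<le> 1"
      using sum_k sum_\<phi> 3 sum_nonneg[of "{1..<k}" \<phi>] \<phi>_pos by (force simp: less_imp_le)
    moreover have "pow2 1" using pow2_inverse_power[of 0] by simp
    ultimately have "multiple (2 * \<phi> k) (2 * 1 - 2 * \<phi> k)"
      by (intro multiple_diff multiple_pow2 pow2_mult2) auto
    then have "multiple (2 * \<phi> k) (2 * (\<Sum>i=1..<k. \<phi> i))" unfolding S by simp
    then have "position m \<phi> k = 2 * (\<Sum>i=1..<k. \<phi> i)"
      using round_up(4)[of "2 * \<phi> k" "2 * (\<Sum>i=1..<k. \<phi> i)"] pos u 3 by (simp add: position_def Let_def)
    then show ?thesis using sum_k u by simp
  qed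
qed

lemma packing_scaled: "packing m (scaled m \<phi>) (position m \<phi>)"
proof
  show "m \<ge> 1" using m3 by simp
  show "pow2 (scaled m \<phi> k)" if "k \<in> {1..Suc m}" for k
    using scaled_pow2[OF that] .
  have pos: "scaled m \<phi> k > 0" if "k \<in> {1..Suc m}" for k
    using scaled_pow2[OF that] pow2_pos by blast
  show last: "scaled m \<phi> (Suc m) = 2" by (simp add: scaled_def)
  show first: "position m \<phi> 1 = 0" by (simp add: position_def Let_def)
  show "position m \<phi> (Suc m) = 2"
    using sum_\<phi> m3 by (simp add: position_def Let_def last atLeastLessThanSuc_atLeastAtMost)
  show "multiple (scaled m \<phi> k) (position m \<phi> k)" if "k \<in> {1..Suc m}" for k
    using round_up(3)[OF pos[OF that]] by (simp add: position_def Let_def)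
  show "position m \<phi> k + scaled m \<phi> k \<le> position m \<phi> (Suc k)" if "k \<in> {1..m}" for k
  proof (cases "k = 1")
    case True
    then show ?thesis
      using first round_up(1)[OF pos[of 2], of "scaled m \<phi> 1"] m3
      by (simp add: position_def Let_def numeral_2_eq_2)
  next
    case False
    then have k: "k \<in> {2..m}" using that by auto
    then have "2 * (\<Sum>i=1..k. \<phi> i) \<le> position m \<phi> (Suc k)"
      using round_up(1)[OF pos[of "Suc k"], of "2 * (\<Sum>i=1..k. \<phi> i)"] that
      by (simp add: position_def Let_def atLeastLessThanSuc_atLeastAtMost)
    then show ?thesis using position_step[OF k] by linarith
  qed
qed

lemma runs_init:
  "runs (Seq rescale init) (input_state m \<phi>)
     (\<lambda>t s. t \<le> 80 \<and> represents m (scaled m \<phi>) 1 [(4, Empty)] s)"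
  unfolding rescale_def init_def
  apply (intro runs_Seq runs_Put runs_Assign runs_If)
  \<comment> \<open>For \<open>m \<ge> 3\<close> the entries 1, 2 and \<open>m\<close> are distinct,
    so doubling entry \<open>m\<close> first does not affect the comparison. Entry 0 of
    \<open>t\<close> is 0 by default, the null pointer for the sentinel's
    \<open>Empty\<close>.\<close>
  using m3
  apply (auto simp: represents_def assign_def put_def input_state_def scaled_def)
  done

lemma runs_program:
  "runs program (input_state m \<phi>) (\<lambda>t s. t \<le> 400 * m \<and>
     (\<exists>T. stored_tree m s (reg s ''root'') T \<and> map fst (codewords T) = [1..<Suc m] \<and>
        (\<forall>(k, c)\<in>set (codewords T). 2 ^ length c * scaled m \<phi> k \<le> 2)))"
proof -
  interpret packing m "scaled m \<phi>" "position m \<phi>" by (rule packing_scaled)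
  have "runs (Seq rescale init) (input_state m \<phi>) (\<lambda>t s.
      runs (Seq build (Assign ''root'' (Get ''t'' (Const 1)))) s (\<lambda>t' s'. t + t' \<le> 400 * m \<and>
     (\<exists>T. stored_tree m s' (reg s' ''root'') T \<and> map fst (codewords T) = [1..<Suc m] \<and>
        (\<forall>(k, c)\<in>set (codewords T). 2 ^ length c * scaled m \<phi> k \<le> 2))))"
  proof (rule runs_mono, rule runs_init)
    fix t :: nat and s
    assume "t \<le> 80 \<and> represents m (scaled m \<phi>) 1 [(4, Empty)] s"
    then show "runs (Seq build (Assign ''root'' (Get ''t'' (Const 1)))) s (\<lambda>t' s'. t + t' \<le> 400 * m \<and>
     (\<exists>T. stored_tree m s' (reg s' ''root'') T \<and> map fst (codewords T) = [1..<Suc m] \<and>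
        (\<forall>(k, c)\<in>set (codewords T). 2 ^ length c * scaled m \<phi> k \<le> 2)))"
      \<comment> \<open>\<open>80 + (300 * m + 120) \<le> 400 * m\<close> holds from
        \<open>m = 2\<close> on.\<close>
      using m3 by (intro runs_mono[OF runs_build_root]) auto
  qed
  then show ?thesis unfolding program_def by (rule runs_Seq)
qed

section \<open>The average length\<close>

lemma average_length_le:
  assumes w: "\<And>k. k \<in> {1..m} \<Longrightarrow> 2 ^ length (w k) * scaled m \<phi> k \<le> 2"
  shows "average_length m \<phi> w \<le>
    entropy m \<phi> + 2 - 2 * \<phi> 1 - 2 * \<phi> m - (\<Sum>i=1..m-1. min (\<phi> i) (\<phi> (i + 1)))"
proof -
  \<comment> \<open>\<open>e k\<close> is the exponent with
    \<open>scaled m \<phi> k = 2 powr e k * \<phi> k\<close>, the number of bits saved against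
    \<open>1 - log 2 (\<phi> k)\<close>.\<close>
  define e where "e = (\<lambda>k. (if k = m then 1 else 0) + (if k = 1 then if \<phi> 1 < \<phi> 2 then 2 else 1 else 0) +
      (if k = 2 then if \<phi> 1 < \<phi> 2 then 0 else 1 else (0::real)))"
  have len: "length (w k) \<le> 1 - log 2 (\<phi> k) - e k" if k: "k \<in> {1..m}" for k
  proof -
    have pos: "scaled m \<phi> k > 0" using scaled_pow2 pow2_pos k by simp
    have "2 ^ length (w k) \<le> 2 / scaled m \<phi> k"
      using w[OF k] pos by (simp add: field_simps)
    then have "log 2 (2 ^ length (w k)) \<le> log 2 (2 / scaled m \<phi> k)"
      using pos by (subst log_le_cancel_iff) auto
    then have "length (w k) \<le> 1 - log 2 (scaled m \<phi> k)"
      using pos by (simp add: log_divide log_nat_power)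
    moreover have "log 2 (scaled m \<phi> k) = log 2 (\<phi> k) + e k"
    proof -
      have "log 2 (2 * x) = 1 + log 2 x" "log 2 (4 * x) = 2 + log 2 x" if "x > 0" for x :: real
        using that log_nat_power[of 2 2 2] by (simp_all add: log_mult)
      then show ?thesis
        using k m3 \<phi>_pos[OF k] by (auto simp: scaled_def e_def)
    qed
    ultimately show ?thesis by simp
  qed
  have "average_length m \<phi> w \<le> (\<Sum>k=1..m. \<phi> k * (1 - log 2 (\<phi> k) - e k))"
    unfolding average_length_def using len \<phi>_pos by (intro sum_mono mult_left_mono) (auto simp: less_imp_le)
  also have "\<dots> = (\<Sum>k=1..m. \<phi> k) + entropy m \<phi> - (\<Sum>k=1..m. \<phi> k * e k)"
    by (simp add: entropy_def right_diff_distrib sum_subtractf)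
  also have "(\<Sum>k=1..m. \<phi> k * e k) = \<phi> m + \<phi> 1 + min (\<phi> 1) (\<phi> 2)"
  proof -
    have "\<phi> k * e k = (if k = m then \<phi> k else 0) +
        (if k = 1 then if \<phi> 1 < \<phi> 2 then 2 * \<phi> k else \<phi> k else 0) +
        (if k = 2 then if \<phi> 1 < \<phi> 2 then 0 else \<phi> k else 0)" for k
      by (simp add: e_def)
    then show ?thesis using m3 by (simp add: sum.distrib sum.delta)
  qed
  finally have E: "average_length m \<phi> w \<le> 1 + entropy m \<phi> - (\<phi> m + \<phi> 1 + min (\<phi> 1) (\<phi> 2))"
    unfolding sum_\<phi> .
  have split: "(\<Sum>i=1..m-1. f i) = f 1 + (\<Sum>i=2..m-1. f i)" for f :: "nat \<Rightarrow> real"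
    using m3 by (subst sum.atLeast_Suc_atMost) (simp_all add: numeral_2_eq_2)
  have "(\<Sum>i=1..m-1. min (\<phi> i) (\<phi> (i + 1))) \<le> min (\<phi> 1) (\<phi> 2) + (\<Sum>i=2..m-1. \<phi> i)"
    unfolding split[of "\<lambda>i. min (\<phi> i) (\<phi> (i + 1))"]
    by (intro add_mono sum_mono) (simp_all add: numeral_2_eq_2)
  also have "(\<Sum>i=2..m-1. \<phi> i) = 1 - \<phi> 1 - \<phi> m"
  proof -
    have "(\<Sum>i=1..Suc (m-1). \<phi> i) = (\<Sum>i=1..m-1. \<phi> i) + \<phi> (Suc (m-1))"
      by simp
    then show ?thesis using sum_\<phi> split[of \<phi>] m3 by simp
  qed
  finally show ?thesis using E by linarith
qed

end

end

theorem corollary4p1: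
  shows "\<exists>(P::com) (c::nat). \<forall>(m::nat) (\<phi>::nat \<Rightarrow> real). dyadic_distribution m \<phi> \<longrightarrow>
    (m \<ge> 3 \<longrightarrow>
      (\<exists>w s t. exec P (input_state m \<phi>) t s \<and> t \<le> c * m \<and> outputs_code m s w \<and>
        alphabetic_code m w \<and>
        average_length m \<phi> w \<le> entropy m \<phi> + 2
          - \<phi> 1 * (2 - log 2 (\<phi> 1) - of_int \<lceil>- log 2 (\<phi> 1)\<rceil>)
          - \<phi> m * (2 - log 2 (\<phi> m) - of_int \<lceil>- log 2 (\<phi> m)\<rceil>)
          - (\<Sum>i=1..m-1. min (\<phi> i) (\<phi> (i+1))))) \<and>
    entropy m \<phi> + 2
          - \<phi> 1 * (2 - log 2 (\<phi> 1) - of_int \<lceil>- log 2 (\<phi> 1)\<rceil>)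
          - \<phi> m * (2 - log 2 (\<phi> m) - of_int \<lceil>- log 2 (\<phi> m)\<rceil>)
          - (\<Sum>i=1..m-1. min (\<phi> i) (\<phi> (i+1)))
      = entropy m \<phi> + 2 - 2 * \<phi> 1 - 2 * \<phi> m - (\<Sum>i=1..m-1. min (\<phi> i) (\<phi> (i+1)))"
proof (intro exI[of _ program] exI[of _ "400::nat"] allI impI, goal_cases)
  case (1 m \<phi>)
  \<comment> \<open>The empty sum is not 1; so 1 and \<open>m\<close> are indices of actual symbols
    even without \<open>m \<ge> 3\<close>.\<close>
  have "m \<ge> 1" using sum_\<phi>[OF 1] by (cases m) auto
  then have eq: "2 - log 2 (\<phi> 1) - of_int \<lceil>- log 2 (\<phi> 1)\<rceil> = 2"
    "2 - log 2 (\<phi> m) - of_int \<lceil>- log 2 (\<phi> m)\<rceil> = 2"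
    using correction_eq_2[OF 1, of 1] correction_eq_2[OF 1, of m] by simp_all
  have "\<exists>w s t. exec program (input_state m \<phi>) t s \<and> t \<le> 400 * m \<and> outputs_code m s w \<and>
      alphabetic_code m w \<and> average_length m \<phi> w \<le>
        entropy m \<phi> + 2 - 2 * \<phi> 1 - 2 * \<phi> m - (\<Sum>i=1..m-1. min (\<phi> i) (\<phi> (i + 1)))"
    if m3: "m \<ge> 3"
  proof -
    obtain t s T where exec: "exec program (input_state m \<phi>) t s" "t \<le> 400 * m"
      and T: "stored_tree m s (reg s ''root'') T" "map fst (codewords T) = [1..<Suc m]"
        "\<forall>(k, c)\<in>set (codewords T). 2 ^ length c * scaled m \<phi> k \<le> 2"
      using runs_program[OF 1 m3] unfolding runs_def by blast
    \<comment> \<open>Each symbol labels exactly one leaf, so the lookup recovers the codeword; the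
      unspecified values outside \<open>{1..m}\<close> do not matter.\<close>
    define w where "w = (\<lambda>k. the (map_of (codewords T) k))"
    have dist: "distinct (map fst (codewords T))" unfolding T(2) by (rule distinct_upt)
    have "map (\<lambda>i. (i, w i)) (map fst (codewords T)) = codewords T"
      unfolding map_map by (rule map_idI) (auto simp: w_def dist)
    then have eq: "codewords T = map (\<lambda>i. (i, w i)) [1..<Suc m]" unfolding T(2) by (rule sym)
    have "2 ^ length (w k) * scaled m \<phi> k \<le> 2" if "k \<in> {1..m}" for k
    proof -
      have "(k, w k) \<in> set (codewords T)" unfolding eq using that by (auto simp del: upt_Suc)
      then show ?thesis using T(3) by blast
    qed
    then have "average_length m \<phi> w \<le>
        entropy m \<phi> + 2 - 2 * \<phi> 1 - 2 * \<phi> m - (\<Sum>i=1..m-1. min (\<phi> i) (\<phi> (i + 1)))"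
      by (rule average_length_le[OF 1 m3])
    moreover have "alphabetic_code m w" using alphabetic_code_codewords[OF eq] m3 by simp
    moreover have "outputs_code m s w" unfolding outputs_code_def using T(1) eq by blast
    ultimately show ?thesis using exec by blast
  qed
  then show ?case unfolding eq by (simp add: mult.commute)
qed

end
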